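(* Assume the change-point model is Markovian, with sufficient statistic $\mathbb S_t\in\mathbb R^\kappa$, link function $\Psi$ and transition function $\Phi$. Let $c>0$, and let $(\mathcal X_c^*,T_c^* )$ be the procedure solving the auxiliary problem $\inf_{(\mathcal X,T)\in\mathcal C}\{c\,\mathsf E_{\gamma,\zeta}[T]+\mathsf P_{\gamma,\zeta}(T<\Theta_{\mathcal X})\}$ that is defined by $$T_c^*=\inf\{t\ge 0:\ 1/(1+\Gamma_t)\le J_c^*(\Gamma_t,\mathbb S_t,0)\},\qquad X^*_{t+1,c}=\arg\min_{k\in[K]}\mathcal T_{c,(k,0)}(J_c^* )(\Gamma_t,\mathbb S_t,0),\quad t\ge 0.$$ Then there exists a function $b_c:\mathbb R^\kappa\to\mathbb R_+=[0,\infty)$ such that $$T_c^*=\inf\{t\ge 0:\ \Gamma_t\ge b_c(\mathbb S_t)\}.$$ In the special case of the memoryless model (i.e. $\kappa=0$), the function $b_c$ is a constant.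
   Context: Setup. Fix $2\le K<\infty$, $[K]=\{1,\dots,K\}$, $\mathbb N=\{1,2,\dots\}$. On a probability space there is a latent process $L_t\in\{0,1\}$, $t\ge0$, with $L_t=0$ for $t<\Theta$ and $L_t=1$ for $t\ge\Theta$ ($\Theta$ is the change-point). At each time $t\in\mathbb N$ a treatment $X_t\in[K]$ is selected and a response $Y_t$ with values in a Polish space $\mathbb Y$ is observed; $\mathcal F_t=\sigma(X_s,Y_s:1\le s\le t)$, $\mathcal F_0$ trivial. An assignment rule $\mathcal X=\{X_t\}$ has $X_1$ deterministic and $X_t$ a (measurable) function of $X_1,\dots,X_{t-1},Y_1,\dots,Y_{t-1}$. Response model: for each $x\in[K]$, $f_x,g_x$ are densities with respect to a $\sigma$-finite measure $\mu$ on $\mathbb Y$; given $X_t=x$, $L_t=i$, $\mathcal F_{t-1}$ and $L_0,\dots,L_{t-1}$, the response $Y_t$ has density $f_x$ if $i=0$ and $g_x$ if $i=1$. Change-point model: $\mathsf P(L_0=1)=\pi_0\in[0,1)$ and $\mathsf P(L_t=1\mid L_{t-1}=0,\mathcal F_{t-1},X_t)=\Pi_t$. The change-point under $\mathcal X$ is denoted $\Theta_{\mathcal X}$. Markovian model: $\Pi_t=\Psi(X_t,\mathbb S_{t-1})$, $\mathbb S_t=\Phi(X_t,\mathbb S_{t-1})$ for $t\in\mathbb N$, where $\mathbb S_0\in\mathbb R^\kappa$ is deterministic, $\kappa\ge0$, $\Psi:[K]\times\mathbb R^\kappa\to[0,1)$ and $\Phi:[K]\times\mathbb R^\kappa\to\mathbb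 R^\kappa$. Memoryless means $\kappa=0$, i.e. $\Pi_t=\Psi(X_t)$. Posterior odds: $\Gamma_t=\mathsf P(L_t=1\mid\mathcal F_t)/\mathsf P(L_t=0\mid\mathcal F_t)$, $\Gamma_0=\pi_0/(1-\pi_0)$. $\mathcal C$ is the class of pairs $(\mathcal X,T)$ with $\mathcal X$ an assignment rule and $T$ an $\{\mathcal F_t\}$-stopping time. $\mathsf P_{\gamma,\zeta},\mathsf E_{\gamma,\zeta}$ denote probability and expectation when $\Gamma_0=\gamma\in[0,\infty)$ and $\mathbb S_0=\zeta\in\mathbb R^\kappa$. Define $J_c^*(\gamma,\zeta,0)=\inf_{(\mathcal X,T)\in\mathcal C}\{c\,\mathsf E_{\gamma,\zeta}[T]+\mathsf P_{\gamma,\zeta}(T<\Theta_{\mathcal X})\}$ and $J_c^*(\gamma,\zeta,1)=0$ (the third coordinate indicates whether the process has already been terminated). For a nonnegative function $J$ and $k\in[K]$, $$\mathcal T_{c,(k,0)}(J)(\gamma,\zeta,0)=c+\int_{\mathbb Y}J\Big(\tfrac{\gamma+\pi}{1-\pi}\tfrac{g_k(y)}{f_k(y)},\,\Phi(k,\zeta),\,0\Big)\tfrac{(\gamma+\pi)g_k(y)+(1-\pi)f_k(y)}{1+\gamma}\,\mu(dy),\quad \pi=\Psi(k,\zeta),$$ i.e. the cost of one more observation plus the expected value of $J$ after assigning treatment $k$ (the action "treatment $k$, do not stop" is written $(k,0)$). *)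

theory Defs
  imports "HOL-Probability.Probability"
begin

text \<open>
  The Euclidean space of dimension \<open>\<kappa>\<close>, where \<open>\<kappa> = 0\<close> must be allowed (a one-point space):
  vectors are the extensional functions on \<open>{..<\<kappa>}\<close>.
\<close>

definition euclid :: "nat \<Rightarrow> (nat \<Rightarrow> real) set" where
  "euclid \<kappa> = ({..<\<kappa>} \<rightarrow>\<^sub>E UNIV)"

record 'y cp_model =
  arms :: nat                                                        \<comment> \<open>\<open>K\<close>\<close>
  base :: "'y measure"                                               \<comment> \<open>\<open>\<mu>\<close>\<close>
  pre  :: "nat \<Rightarrow> 'y \<Rightarrow> real"                                         \<comment> \<open>\<open>f\<^sub>x\<close>\<close>
  post :: "nat \<Rightarrow> 'y \<Rightarrow> real"                                         \<comment> \<open>\<open>g\<^sub>x\<close>\<close>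
  stat_dim :: nat                                                        \<comment> \<open>\<open>\<kappa>\<close>\<close>
  link :: "nat \<Rightarrow> (nat \<Rightarrow> real) \<Rightarrow> real"                               \<comment> \<open>\<open>\<Psi>\<close>\<close>
  transition :: "nat \<Rightarrow> (nat \<Rightarrow> real) \<Rightarrow> (nat \<Rightarrow> real)"                     \<comment> \<open>\<open>\<Phi>\<close>\<close>

definition prob_density :: "'y measure \<Rightarrow> ('y \<Rightarrow> real) \<Rightarrow> bool" where
  "prob_density \<mu> h \<longleftrightarrow>
     h \<in> borel_measurable \<mu> \<and> (\<forall>y. 0 \<le> h y) \<and> (\<integral>\<^sup>+ y. ennreal (h y) \<partial>\<mu>) = 1"

definition markov_model :: "('y::polish_space) cp_model \<Rightarrow> bool" where
  "markov_model M \<longleftrightarrow>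
     2 \<le> arms M \<and>
     sets (base M) = sets borel \<and> sigma_finite_measure (base M) \<and>
     (\<forall>x\<in>{1..arms M}. prob_density (base M) (pre M x) \<and> prob_density (base M) (post M x)) \<and>
     (\<forall>x\<in>{1..arms M}. \<forall>s\<in>euclid (stat_dim M). link M x s \<in> {0..<1} \<and> transition M x s \<in> euclid (stat_dim M))"

text \<open>
  Sample space: a path \<open>\<omega>\<close> has \<open>\<omega> t = (L\<^sub>t, Y\<^sub>t)\<close>, with \<open>True\<close> for \<open>L\<^sub>t = 1\<close>; the response
  component of \<open>\<omega> 0\<close> is a dummy.  Treatments and sufficient statistics are functions of the path.
\<close>

type_synonym 'y path = "nat \<Rightarrow> bool \<times> 'y"

definition coord_space :: "(bool \<times> 'y::polish_space) measure" where
  "coord_space = count_space UNIV \<Otimes>\<^sub>M borel"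

definition latent :: "nat \<Rightarrow> 'y path \<Rightarrow> bool" where
  "latent t \<omega> = fst (\<omega> t)"

definition response :: "nat \<Rightarrow> 'y path \<Rightarrow> 'y" where
  "response t \<omega> = snd (\<omega> t)"

definition change_point :: "'y path \<Rightarrow> enat" where
  "change_point \<omega> = (INF t\<in>{t. latent t \<omega>}. enat t)"

text \<open>
  An assignment rule \<open>\<delta>\<close> yields \<open>X\<^sub>t = \<delta> t (X\<^sub>s, Y\<^sub>s)\<^sub>1\<^sub>\<le>\<^sub>s\<^sub><\<^sub>t\<close>.  The history space for \<open>t = 1\<close> has a
  single point, so \<open>X\<^sub>1\<close> is deterministic.
\<close>

type_synonym 'y rule = "nat \<Rightarrow> (nat \<Rightarrow> nat \<times> 'y) \<Rightarrow> nat"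

definition hist_space :: "('y::polish_space) cp_model \<Rightarrow> nat set \<Rightarrow> (nat \<Rightarrow> nat \<times> 'y) measure" where
  "hist_space M I = (\<Pi>\<^sub>M s\<in>I. count_space {1..arms M} \<Otimes>\<^sub>M borel)"

definition assignment_rule :: "('y::polish_space) cp_model \<Rightarrow> 'y rule \<Rightarrow> bool" where
  "assignment_rule M \<delta> \<longleftrightarrow>
     (\<forall>t\<ge>1. \<delta> t \<in> hist_space M {1..<t} \<rightarrow>\<^sub>M count_space {1..arms M})"

function treatment :: "'y rule \<Rightarrow> nat \<Rightarrow> 'y path \<Rightarrow> nat" where
  "treatment \<delta> t \<omega> =
     \<delta> t (\<lambda>s. if s \<in> {1..<t} then (treatment \<delta> s \<omega>, response s \<omega>) else undefined)"
  by pat_completeness auto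
termination by (relation "Wellfounded.measure (\<lambda>(\<delta>, t, \<omega>). t)") auto

declare treatment.simps [simp del]

primrec stat :: "'y cp_model \<Rightarrow> (nat \<Rightarrow> real) \<Rightarrow> (nat \<Rightarrow> nat) \<Rightarrow> nat \<Rightarrow> (nat \<Rightarrow> real)" where
  "stat M \<zeta> x 0 = \<zeta>"
| "stat M \<zeta> x (Suc t) = transition M (x (Suc t)) (stat M \<zeta> x t)"

definition suff_stat ::
  "'y cp_model \<Rightarrow> 'y rule \<Rightarrow> (nat \<Rightarrow> real) \<Rightarrow> nat \<Rightarrow> 'y path \<Rightarrow> (nat \<Rightarrow> real)" where
  "suff_stat M \<delta> \<zeta> t \<omega> = stat M \<zeta> (\<lambda>s. treatment \<delta> s \<omega>) t"

definition filt :: "('y::polish_space) cp_model \<Rightarrow> 'y rule \<Rightarrow> nat \<Rightarrow> 'y path measure" where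
  "filt M \<delta> t =
     vimage_algebra UNIV (\<lambda>\<omega>. \<lambda>s\<in>{1..t}. (treatment \<delta> s \<omega>, response s \<omega>)) (hist_space M {1..t})"

text \<open>
  Odds take values in \<open>[0, \<infinity>]\<close>: the posterior odds become infinite after a response at which
  the pre-change density vanishes.  Odds \<open>\<infinity>\<close> correspond to \<open>\<pi>\<^sub>0 = 1\<close>.
\<close>

definition prior_prob :: "ennreal \<Rightarrow> real" where
  "prior_prob \<gamma> = (if \<gamma> = \<infinity> then 1 else enn2real \<gamma> / (1 + enn2real \<gamma>))"

text \<open>
  Conditional law of \<open>(L\<^sub>t, Y\<^sub>t)\<close> given \<open>(L\<^sub>s, Y\<^sub>s)\<^sub>s\<^sub><\<^sub>t\<close>: for \<open>t \<ge> 1\<close>, with \<open>x = X\<^sub>t\<close>, the state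
  \<open>L\<^sub>t\<close> is \<open>1\<close> with probability \<open>\<Pi>\<^sub>t = \<Psi>(X\<^sub>t, S\<^sub>t\<^sub>-\<^sub>1)\<close> if \<open>L\<^sub>t\<^sub>-\<^sub>1 = 0\<close> and surely if \<open>L\<^sub>t\<^sub>-\<^sub>1 = 1\<close>,
  and \<open>Y\<^sub>t\<close> then has density \<open>f\<^sub>x\<close> or \<open>g\<^sub>x\<close> according to \<open>L\<^sub>t\<close>.
\<close>

definition step_kernel ::
  "('y::polish_space) cp_model \<Rightarrow> 'y rule \<Rightarrow> ennreal \<Rightarrow> (nat \<Rightarrow> real) \<Rightarrow> nat \<Rightarrow> 'y path \<Rightarrow>
     (bool \<times> 'y) measure" where
  "step_kernel M \<delta> \<gamma> \<zeta> t \<omega> =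
     (if t = 0 then
        distr (measure_pmf (bernoulli_pmf (prior_prob \<gamma>))) coord_space (\<lambda>l. (l, undefined))
      else
        let x = treatment \<delta> t \<omega>;
            p = (if latent (t - 1) \<omega> then 1 else link M x (suff_stat M \<delta> \<zeta> (t - 1) \<omega>))
        in density (measure_pmf (bernoulli_pmf p) \<Otimes>\<^sub>M base M)
             (\<lambda>(l, y). ennreal (if l then post M x y else pre M x y)))"

definition law ::
  "('y::polish_space) cp_model \<Rightarrow> 'y rule \<Rightarrow> ennreal \<Rightarrow> (nat \<Rightarrow> real) \<Rightarrow> 'y path measure" where
  "law M \<delta> \<gamma> \<zeta> =
     projective_family.lim UNIV
       (Ionescu_Tulcea.CI (step_kernel M \<delta> \<gamma> \<zeta>) (\<lambda>_. coord_space)) (\<lambda>_. coord_space)"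

lemma space_coord_space [simp]: "space coord_space = UNIV"
  by (simp add: coord_space_def space_pair_measure)

lemma treatment_measurable:
  assumes "assignment_rule M \<delta>" "1 \<le> t" "{1..<t} \<subseteq> I"
  shows "treatment \<delta> t \<in> (\<Pi>\<^sub>M i\<in>I. coord_space) \<rightarrow>\<^sub>M count_space {1..arms M}"
  using assms(2,3)
proof (induction t rule: less_induct)
  case (less t)
  let ?h = "\<lambda>\<omega> s. if s \<in> {1..<t} then (treatment \<delta> s \<omega>, response s \<omega>) else undefined"
  have "(\<lambda>\<omega>. \<lambda>s\<in>{1..<t}. (treatment \<delta> s \<omega>, response s \<omega>))
      \<in> (\<Pi>\<^sub>M i\<in>I. coord_space) \<rightarrow>\<^sub>M hist_space M {1..<t}"
    unfolding hist_space_def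
  proof (rule measurable_restrict)
    fix s assume s: "s \<in> {1..<t}"
    have "treatment \<delta> s \<in> (\<Pi>\<^sub>M i\<in>I. coord_space) \<rightarrow>\<^sub>M count_space {1..arms M}"
      using s less.prems by (intro less.IH) auto
    moreover have "(\<lambda>\<omega>. \<omega> s) \<in> (\<Pi>\<^sub>M i\<in>I. coord_space) \<rightarrow>\<^sub>M coord_space"
      using s less.prems by (intro measurable_component_singleton) auto
    then have "response s \<in> (\<Pi>\<^sub>M i\<in>I. coord_space) \<rightarrow>\<^sub>M borel"
      unfolding response_def coord_space_def by measurable
    ultimately show "(\<lambda>\<omega>. (treatment \<delta> s \<omega>, response s \<omega>))
        \<in> (\<Pi>\<^sub>M i\<in>I. coord_space) \<rightarrow>\<^sub>M count_space {1..arms M} \<Otimes>\<^sub>M borel"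
      by (rule measurable_Pair)
  qed
  then have "?h \<in> (\<Pi>\<^sub>M i\<in>I. coord_space) \<rightarrow>\<^sub>M hist_space M {1..<t}"
    by (simp add: restrict_def)
  moreover have "\<delta> t \<in> hist_space M {1..<t} \<rightarrow>\<^sub>M count_space {1..arms M}"
    using assms(1) less.prems by (simp add: assignment_rule_def)
  ultimately have "(\<lambda>\<omega>. \<delta> t (?h \<omega>)) \<in> (\<Pi>\<^sub>M i\<in>I. coord_space) \<rightarrow>\<^sub>M count_space {1..arms M}"
    by (rule measurable_compose)
  moreover have "treatment \<delta> t = (\<lambda>\<omega>. \<delta> t (?h \<omega>))"
    by (rule ext) (rule treatment.simps)
  ultimately show ?case by simp
qed

lemma stat_cong: "(\<And>s. 1 \<le> s \<Longrightarrow> s \<le> t \<Longrightarrow> x s = x' s) \<Longrightarrow> stat M \<zeta> x t = stat M \<zeta> x' t"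
  by (induction t) auto

lemma stat_in_euclid:
  assumes "markov_model M" "\<zeta> \<in> euclid (stat_dim M)" "\<And>s. 1 \<le> s \<Longrightarrow> s \<le> t \<Longrightarrow> x s \<in> {1..arms M}"
  shows "stat M \<zeta> x t \<in> euclid (stat_dim M)"
  using assms(3) by (induction t) (use assms in \<open>auto simp: markov_model_def\<close>)

lemma prior_prob_bounds: "0 \<le> prior_prob \<gamma>" "prior_prob \<gamma> \<le> 1"
  by (auto simp: prior_prob_def add_nonneg_nonneg intro!: divide_nonneg_nonneg divide_le_eq_1_pos[THEN iffD2] add_pos_nonneg)

lemma response_density_prob:
  fixes M :: "('y::polish_space) cp_model"
  assumes M: "markov_model M" and x: "x \<in> {1..arms M}"
  shows "density (measure_pmf q \<Otimes>\<^sub>M base M)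
             (\<lambda>(l, y). ennreal (if l then post M x y else pre M x y))
           \<in> space (prob_algebra coord_space)"
proof -
  interpret sigma_finite_measure "base M"
    using M by (simp add: markov_model_def)
  have [measurable_cong]: "sets (base M) = sets borel"
    using M by (simp add: markov_model_def)
  have d: "prob_density (base M) (pre M x)" "prob_density (base M) (post M x)"
    using M x by (auto simp: markov_model_def)
  have [measurable]: "pre M x \<in> borel_measurable (base M)" "post M x \<in> borel_measurable (base M)"
    using d by (auto simp: prob_density_def)
  let ?D = "\<lambda>(l, y). ennreal (if l then post M x y else pre M x y)"
  have D: "?D \<in> borel_measurable (measure_pmf q \<Otimes>\<^sub>M base M)"
    by measurable
  have "emeasure (density (measure_pmf q \<Otimes>\<^sub>M base M) ?D)
          (space (measure_pmf q \<Otimes>\<^sub>M base M)) = (\<integral>\<^sup>+ z. ?D z \<partial>(measure_pmf q \<Otimes>\<^sub>M base M))"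
    using D by (subst emeasure_density) (auto intro!: nn_integral_cong)
  also have "\<dots> = (\<integral>\<^sup>+ l. \<integral>\<^sup>+ y. ?D (l, y) \<partial>base M \<partial>measure_pmf q)"
    by (rule nn_integral_fst[symmetric, OF D])
  also have "\<dots> = (\<integral>\<^sup>+ l. 1 \<partial>measure_pmf q)"
  proof (rule nn_integral_cong)
    show "(\<integral>\<^sup>+ y. ?D (l, y) \<partial>base M) = 1" for l
      using d by (cases l) (auto simp: prob_density_def)
  qed
  also have "\<dots> = 1"
    by simp
  finally have "prob_space (density (measure_pmf q \<Otimes>\<^sub>M base M) ?D)"
    by (intro prob_spaceI) simp
  moreover have "sets (density (measure_pmf q \<Otimes>\<^sub>M base M) ?D) = sets coord_space"
    unfolding coord_space_def sets_density
    by (rule sets_pair_measure_cong) (use M in \<open>auto simp: markov_model_def\<close>)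
  ultimately show ?thesis
    by (simp add: space_prob_algebra)
qed

lemma step_kernel_measurable:
  fixes M :: "('y::polish_space) cp_model"
  assumes M: "markov_model M" and \<delta>: "assignment_rule M \<delta>"
  shows "step_kernel M \<delta> \<gamma> \<zeta> t \<in> (\<Pi>\<^sub>M i\<in>{0..<t}. coord_space) \<rightarrow>\<^sub>M prob_algebra coord_space"
proof (cases "t = 0")
  case True
  have "(\<lambda>l. (l, undefined)) \<in> measure_pmf (bernoulli_pmf (prior_prob \<gamma>)) \<rightarrow>\<^sub>M
      (coord_space :: (bool \<times> 'y) measure)"
    by (simp add: Pi_iff)
  then have "prob_space (distr (measure_pmf (bernoulli_pmf (prior_prob \<gamma>)))
      (coord_space :: (bool \<times> 'y) measure) (\<lambda>l. (l, undefined)))"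
    by (rule measure_pmf.prob_space_distr)
  then have "distr (measure_pmf (bernoulli_pmf (prior_prob \<gamma>)))
      (coord_space :: (bool \<times> 'y) measure) (\<lambda>l. (l, undefined)) \<in> space (prob_algebra coord_space)"
    by (simp add: space_prob_algebra)
  then show ?thesis
    using True by (simp add: step_kernel_def[abs_def])
next
  case False
  let ?N = "\<Pi>\<^sub>M i\<in>{0..<t}. (coord_space :: (bool \<times> 'y) measure)"
  define H where "H = ({1..t} \<rightarrow>\<^sub>E {1..arms M})"
  define G where "G = (\<lambda>(x, l). density (measure_pmf (bernoulli_pmf
      (if l then 1 else link M (x t) (stat M \<zeta> x (t - 1)))) \<Otimes>\<^sub>M base M)
      (\<lambda>(l, y). ennreal (if l then post M (x t) y else pre M (x t) y)))"
  have "(\<lambda>\<omega>. \<lambda>s\<in>{1..t}. treatment \<delta> s \<omega>) \<in> ?N \<rightarrow>\<^sub>M (\<Pi>\<^sub>M s\<in>{1..t}. count_space {1..arms M})"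
    by (intro measurable_restrict treatment_measurable[OF \<delta>]) auto
  then have x: "(\<lambda>\<omega>. \<lambda>s\<in>{1..t}. treatment \<delta> s \<omega>) \<in> ?N \<rightarrow>\<^sub>M count_space H"
    by (simp add: H_def count_space_PiM_finite)
  have "(\<lambda>\<omega>. \<omega> (t - 1)) \<in> ?N \<rightarrow>\<^sub>M coord_space"
    using False by (intro measurable_component_singleton) auto
  then have l: "latent (t - 1) \<in> ?N \<rightarrow>\<^sub>M count_space UNIV"
    unfolding latent_def coord_space_def by measurable
  have "finite H"
    by (simp add: H_def finite_PiE)
  then have "count_space H \<Otimes>\<^sub>M count_space (UNIV :: bool set) = count_space (H \<times> UNIV)"
    by (intro pair_measure_count_space) auto
  then have xl: "(\<lambda>\<omega>. (\<lambda>s\<in>{1..t}. treatment \<delta> s \<omega>, latent (t - 1) \<omega>)) \<in> ?N \<rightarrow>\<^sub>M count_space (H \<times> UNIV)"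
    using measurable_Pair[OF x l] by simp
  have "G \<in> count_space (H \<times> UNIV) \<rightarrow>\<^sub>M prob_algebra coord_space"
    using False response_density_prob[OF M] by (auto simp: G_def H_def PiE_iff)
  from measurable_compose[OF xl this] show ?thesis
  proof (rule measurable_cong[THEN iffD1, rotated])
    fix \<omega> assume "\<omega> \<in> space ?N"
    have "stat M \<zeta> (\<lambda>s\<in>{1..t}. treatment \<delta> s \<omega>) (t - 1) = suff_stat M \<delta> \<zeta> (t - 1) \<omega>"
      unfolding suff_stat_def by (rule stat_cong) auto
    moreover have "(\<lambda>s\<in>{1..t}. treatment \<delta> s \<omega>) t = treatment \<delta> t \<omega>"
      using False by simp
    ultimately show "G (\<lambda>s\<in>{1..t}. treatment \<delta> s \<omega>, latent (t - 1) \<omega>) = step_kernel M \<delta> \<gamma> \<zeta> t \<omega>"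
      using False by (simp only: G_def step_kernel_def Let_def prod.case if_False)
  qed
qed

lemma Ionescu_Tulcea_step_kernel:
  fixes M :: "('a::polish_space) cp_model"
  assumes "markov_model M" "assignment_rule M \<delta>"
  shows "Ionescu_Tulcea (step_kernel M \<delta> \<gamma> \<zeta>) (\<lambda>_. coord_space)"
proof (rule Ionescu_Tulcea.intro)
  fix i
  note k = step_kernel_measurable[OF assms, of \<gamma> \<zeta> i]
  show "step_kernel M \<delta> \<gamma> \<zeta> i \<in> (\<Pi>\<^sub>M i\<in>{0..<i}. coord_space) \<rightarrow>\<^sub>M subprob_algebra coord_space"
    using k by (rule measurable_prob_algebraD)
  fix x assume "x \<in> space (\<Pi>\<^sub>M i\<in>{0..<i}. (coord_space :: (bool \<times> 'a) measure))"
  from measurable_space[OF k this] show "prob_space (step_kernel M \<delta> \<gamma> \<zeta> i x)"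
    by (simp add: space_prob_algebra)
qed

lemma
  fixes M :: "('a::polish_space) cp_model"
  assumes "markov_model M" "assignment_rule M \<delta>"
  shows sets_law: "sets (law M \<delta> \<gamma> \<zeta>) = sets (\<Pi>\<^sub>M i\<in>UNIV. coord_space)"
    and prob_space_law: "prob_space (law M \<delta> \<gamma> \<zeta>)"
proof -
  interpret Ionescu_Tulcea "step_kernel M \<delta> \<gamma> \<zeta>" "\<lambda>_. coord_space"
    by (rule Ionescu_Tulcea_step_kernel[OF assms])
  show s: "sets (law M \<delta> \<gamma> \<zeta>) = sets (\<Pi>\<^sub>M i\<in>UNIV. coord_space)"
    by (simp add: law_def)
  have "emeasure PF.lim (PF.emb UNIV {} {\<lambda>_. undefined}) = emeasure (CI {}) {\<lambda>_. undefined}"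
    by (rule lim) (auto simp: sets_PiM_empty)
  also have "\<dots> = 1"
    using prob_space.emeasure_space_1[OF PF.prob_space_P[of "{}"]] PF.space_P[of "{}"] by (simp add: space_PiM)
  also have "PF.emb UNIV {} {\<lambda>_. undefined} = space PF.lim"
    by (auto simp: prod_emb_def space_PiM)
  finally show "prob_space (law M \<delta> \<gamma> \<zeta>)"
    by (intro prob_spaceI) (simp add: law_def)
qed

text \<open>
  Conditional probabilities are only determined almost surely, so the posterior odds are any
  adapted version \<open>\<Gamma>\<close> of the quotient.
\<close>

definition posterior_odds ::
  "('y::polish_space) cp_model \<Rightarrow> 'y rule \<Rightarrow> ennreal \<Rightarrow> (nat \<Rightarrow> real) \<Rightarrow>
     (nat \<Rightarrow> 'y path \<Rightarrow> ennreal) \<Rightarrow> bool" where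
  "posterior_odds M \<delta> \<gamma> \<zeta> \<Gamma> \<longleftrightarrow>
     (\<forall>t. \<Gamma> t \<in> borel_measurable (filt M \<delta> t) \<and>
        (AE \<omega> in law M \<delta> \<gamma> \<zeta>.
           \<Gamma> t \<omega> =
             nn_cond_exp (law M \<delta> \<gamma> \<zeta>) (filt M \<delta> t) (indicator {\<omega>. latent t \<omega>}) \<omega> /
             nn_cond_exp (law M \<delta> \<gamma> \<zeta>) (filt M \<delta> t) (indicator {\<omega>. \<not> latent t \<omega>}) \<omega>))"

definition procedures :: "('y::polish_space) cp_model \<Rightarrow> ('y rule \<times> ('y path \<Rightarrow> enat)) set" where
  "procedures M =
     {(\<delta>, T). assignment_rule M \<delta> \<and> (\<forall>t. Measurable.pred (filt M \<delta> t) (\<lambda>\<omega>. T \<omega> \<le> enat t))}"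

definition aux_cost ::
  "('y::polish_space) cp_model \<Rightarrow> real \<Rightarrow> ennreal \<Rightarrow> (nat \<Rightarrow> real) \<Rightarrow>
     'y rule \<Rightarrow> ('y path \<Rightarrow> enat) \<Rightarrow> ennreal" where
  "aux_cost M c \<gamma> \<zeta> \<delta> T =
     ennreal c * (\<integral>\<^sup>+ \<omega>. ennreal_of_enat (T \<omega>) \<partial>law M \<delta> \<gamma> \<zeta>) +
     emeasure (law M \<delta> \<gamma> \<zeta>) {\<omega>. T \<omega> < change_point \<omega>}"

definition opt_cost ::
  "('y::polish_space) cp_model \<Rightarrow> real \<Rightarrow> ennreal \<Rightarrow> (nat \<Rightarrow> real) \<Rightarrow> bool \<Rightarrow> ennreal" where
  "opt_cost M c \<gamma> \<zeta> stopped =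
     (if stopped then 0 else (INF (\<delta>, T)\<in>procedures M. aux_cost M c \<gamma> \<zeta> \<delta> T))"

definition bellman_op ::
  "('y::polish_space) cp_model \<Rightarrow> real \<Rightarrow> nat \<Rightarrow> (ennreal \<Rightarrow> (nat \<Rightarrow> real) \<Rightarrow> bool \<Rightarrow> ennreal) \<Rightarrow>
     ennreal \<Rightarrow> (nat \<Rightarrow> real) \<Rightarrow> ennreal" where
  "bellman_op M c k J \<gamma> \<zeta> =
     (let p = link M k \<zeta> in
      ennreal c +
      (\<integral>\<^sup>+ y. J ((\<gamma> + ennreal p) / ennreal (1 - p) * (ennreal (post M k y) / ennreal (pre M k y)))
               (transition M k \<zeta>) False *
             (((\<gamma> + ennreal p) * ennreal (post M k y) + ennreal (1 - p) * ennreal (pre M k y)) /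
              (1 + \<gamma>)) \<partial>base M))"

text \<open>
  \<open>(\<delta>, T)\<close> is the procedure \<open>(\<X>\<^sub>c\<^sup>*, T\<^sub>c\<^sup>*)\<close> for the initial values \<open>\<gamma>, \<zeta>\<close>,
  where \<open>\<Gamma>\<close> is its posterior odds process; ties in the minimum may be broken arbitrarily.
\<close>

definition star_procedure ::
  "('y::polish_space) cp_model \<Rightarrow> real \<Rightarrow> ennreal \<Rightarrow> (nat \<Rightarrow> real) \<Rightarrow>
     (nat \<Rightarrow> 'y path \<Rightarrow> ennreal) \<Rightarrow> 'y rule \<Rightarrow> ('y path \<Rightarrow> enat) \<Rightarrow> bool" where
  "star_procedure M c \<gamma> \<zeta> \<Gamma> \<delta> T \<longleftrightarrow>
     assignment_rule M \<delta> \<and>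
     posterior_odds M \<delta> \<gamma> \<zeta> \<Gamma> \<and>
     (\<forall>t \<omega>. is_arg_min
        (\<lambda>k. bellman_op M c k (opt_cost M c) (\<Gamma> t \<omega>) (suff_stat M \<delta> \<zeta> t \<omega>))
        (\<lambda>k. k \<in> {1..arms M}) (treatment \<delta> (Suc t) \<omega>)) \<and>
     (\<forall>\<omega>. T \<omega> =
        (INF t\<in>{t. 1 / (1 + \<Gamma> t \<omega>) \<le> opt_cost M c (\<Gamma> t \<omega>) (suff_stat M \<delta> \<zeta> t \<omega>) False}. enat t))"

end

theory Submission
  imports Defs
begin

text \<open>
  The laws for different initial odds \<open>\<gamma>\<close> differ only in the law of \<open>L\<^sub>0\<close>, so the law for
  \<open>\<gamma>\<close> is the mixture of those for \<open>\<infinity>\<close> and \<open>0\<close> with weights \<open>\<gamma>/(1+\<gamma>)\<close> and \<open>1/(1+\<gamma>)\<close>.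
  Hence \<open>(1+\<gamma>)\<close> times the cost of a fixed procedure is an affine function of \<open>\<gamma>\<close> with nonnegative slope,
  and stopping is optimal at \<open>\<gamma>\<close> iff all these affine functions are at least \<open>1\<close>.
  Truncation shows that it is enough to consider procedures with a bounded stopping time; their
  slopes are finite (an infinite slope would make the function jump at \<open>\<gamma> = 0\<close>), so the odds at which
  one stops form an upward closed and topologically closed set.
  It contains \<open>1/c\<close>: as \<open>\<F>\<^sub>0\<close> is trivial, a procedure either stops at once, at cost
  \<open>1/(1+\<gamma>)\<close>, or takes an observation, at cost at least \<open>c\<close>.  So it is a half-line \<open>[b, \<infinity>]\<close>.
\<close>

section \<open>Extended numbers\<close>

lemma divide_le_iff_ennreal:
  fixes a b x :: ennreal
  assumes "b \<noteq> 0" "b \<noteq> \<infinity>"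
  shows "a / b \<le> x \<longleftrightarrow> a \<le> b * x"
proof
  assume "a / b \<le> x"
  then have "b * (a / b) \<le> b * x"
    by (rule mult_left_mono) simp
  then show "a \<le> b * x"
    using assms by (simp add: ennreal_times_divide mult_divide_eq_ennreal mult.commute[of b])
next
  assume "a \<le> b * x"
  then show "a / b \<le> x"
    using assms by (intro divide_le_posI_ennreal) (auto simp: zero_less_iff_neq_zero)
qed

lemma borel_measurable_enatI:
  fixes f :: "'a \<Rightarrow> enat"
  assumes "\<And>n. Measurable.pred M (\<lambda>x. f x \<le> enat n)"
  shows "f \<in> borel_measurable M"
proof (rule borel_measurableI_le)
  show "{x \<in> space M. f x \<le> a} \<in> sets M" for a
    using assms by (cases a) (auto simp: pred_def)
qed

lemma borel_measurable_ennreal_of_enat [measurable]: "ennreal_of_enat \<in> borel_measurable borel"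
  by (intro borel_measurable_continuous_onI continuous_at_imp_continuous_on ballI isCont_ennreal_of_enat)

lemma Markov_inequality_enat:
  fixes f :: "'a \<Rightarrow> enat"
  assumes [measurable]: "f \<in> borel_measurable M"
  shows "of_nat n * emeasure M {x \<in> space M. enat n \<le> f x} \<le> (\<integral>\<^sup>+ x. ennreal_of_enat (f x) \<partial>M)"
proof -
  have "of_nat n * emeasure M {x \<in> space M. enat n \<le> f x} =
      (\<integral>\<^sup>+ x. of_nat n * indicator {x \<in> space M. enat n \<le> f x} x \<partial>M)"
    by (rule nn_integral_cmult_indicator[symmetric]) measurable
  also have "\<dots> \<le> (\<integral>\<^sup>+ x. ennreal_of_enat (f x) \<partial>M)"
    by (intro nn_integral_mono) (auto split: split_indicator simp flip: ennreal_of_enat_enat)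
  finally show ?thesis .
qed

lemma tendsto_emeasure_enat_tail:
  fixes f :: "'a \<Rightarrow> enat"
  assumes measurable_f: "f \<in> borel_measurable M" and finite_f: "(\<integral>\<^sup>+ x. ennreal_of_enat (f x) \<partial>M) < \<infinity>"
  shows "(\<lambda>n. emeasure M {x \<in> space M. enat n < f x}) \<longlonglongrightarrow> 0"
proof -
  let ?e = "\<integral>\<^sup>+ x. ennreal_of_enat (f x) \<partial>M"
  have "emeasure M {x \<in> space M. enat n < f x} \<le> ennreal (1 / Suc n) * ?e" for n
  proof -
    have "ennreal (1 / Suc n) * (of_nat (Suc n) * emeasure M {x \<in> space M. enat (Suc n) \<le> f x}) \<le>
        ennreal (1 / Suc n) * ?e"
      by (intro mult_left_mono Markov_inequality_enat measurable_f) simp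
    moreover have "ennreal (1 / Suc n) * of_nat (Suc n) = 1"
      by (simp add: ennreal_of_nat_eq_real_of_nat flip: ennreal_mult del: of_nat_Suc)
    ultimately show ?thesis
      by (simp add: Suc_ile_eq mult.assoc[symmetric])
  qed
  then have bound: "\<forall>\<^sub>F n in sequentially. emeasure M {x \<in> space M. enat n < f x} \<le> ennreal (1 / Suc n) * ?e"
    by (rule always_eventually[OF allI])
  have "(\<lambda>n. ennreal (1 / Suc n)) \<longlonglongrightarrow> ennreal 0"
    by (intro tendsto_ennrealI lim_1_over_n[THEN LIMSEQ_Suc])
  then have "(\<lambda>n. ennreal (1 / Suc n) * ?e) \<longlonglongrightarrow> ennreal 0 * ?e"
    using finite_f by (intro tendsto_mult_ennreal tendsto_const) auto
  then have "(\<lambda>n. ennreal (1 / Suc n) * ?e) \<longlonglongrightarrow> 0"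
    by simp
  from tendsto_sandwich[OF _ bound tendsto_const this] show ?thesis
    by simp
qed

section \<open>Mixtures of Ionescu-Tulcea laws\<close>

lemma Ionescu_Tulcea_C_cong:
  assumes kernel_P: "Ionescu_Tulcea P M" and kernel_Q: "Ionescu_Tulcea Q M" and tail: "\<And>i. n \<le> i \<Longrightarrow> P i = Q i"
  shows "Ionescu_Tulcea.C P M n m = Ionescu_Tulcea.C Q M n m"
proof -
  interpret P: Ionescu_Tulcea P M by (rule kernel_P)
  interpret Q: Ionescu_Tulcea Q M by (rule kernel_Q)
  have eP_tail: "P.eP i = Q.eP i" if "n \<le> i" for i
    using tail[OF that] by (simp add: fun_eq_iff P.eP_def Q.eP_def)
  show ?thesis
  proof (induction m)
    case (Suc m)
    then show ?case
      by (intro ext) (simp add: eP_tail)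
  qed (simp add: fun_eq_iff)
qed

context Ionescu_Tulcea
begin

lemma emeasure_lim_emb_eq_C:
  assumes "J \<subseteq> {0..<n}" "X \<in> sets (PiM J M)"
  shows "emeasure PF.lim (PF.emb UNIV J X) = emeasure (C 0 n (\<lambda>_. undefined)) (PF.emb {0..<n} J X)"
  using assms by (simp add: lim emeasure_CI finite_subset)

lemma prob_space_lim: "prob_space PF.lim"
proof (rule prob_spaceI)
  let ?u = "\<lambda>_. undefined"
  have undefined_in_space: "?u \<in> space (PiM {0..<0} M)"
    by (simp add: space_PiM)
  have "emeasure PF.lim (PF.emb UNIV {} (space (PiM {} M))) =
      emeasure (C 0 0 ?u) (PF.emb {0..<0} {} (space (PiM {} M)))"
    by (rule emeasure_lim_emb_eq_C) auto
  also have "\<dots> = emeasure (C 0 0 ?u) (space (C 0 0 ?u))"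
    by (simp add: prod_emb_def space_PiM)
  also have "\<dots> = 1"
    by (rule prob_space.emeasure_space_1[OF prob_space_C[OF undefined_in_space]])
  also have "PF.emb UNIV {} (space (PiM {} M)) = space PF.lim"
    by (auto simp: prod_emb_def space_PiM)
  finally show "emeasure PF.lim (space PF.lim) = 1" .
qed

lemma C_0_1: "C 0 1 (\<lambda>_. undefined) = eP 0 (\<lambda>_. undefined)"
  using bind_return[OF measurable_eP, of "\<lambda>_. undefined" 0] by (simp add: space_PiM)

lemma emeasure_lim_component_0:
  assumes sets_A: "A \<in> sets (M 0)"
  shows "emeasure PF.lim {\<omega> \<in> space PF.lim. \<omega> 0 \<in> A} = emeasure (P 0 (\<lambda>_. undefined)) A"
proof -
  let ?u = "\<lambda>_. undefined" and ?X = "\<Pi>\<^sub>E i\<in>{0}. A"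
  have sets_X: "?X \<in> sets (PiM {0} M)"
    using sets_A by (intro sets_PiM_I_finite) auto
  have "{\<omega> \<in> space PF.lim. \<omega> 0 \<in> A} = PF.emb UNIV {0} ?X"
    by (auto simp: prod_emb_def space_PiM PiE_iff)
  also have "emeasure PF.lim \<dots> = emeasure (eP 0 ?u) (PF.emb {0..<1} {0} ?X)"
    using emeasure_lim_emb_eq_C[OF _ sets_X, of 1] by (simp only: C_0_1) simp
  also have "\<dots> = emeasure (P 0 ?u) ((\<lambda>x. ?u(0 := x)) -` PF.emb {0..<1} {0} ?X \<inter> space (M 0))"
    using sets_X by (intro emeasure_eP) (auto simp: space_PiM)
  also have "(\<lambda>x. ?u(0 := x)) -` PF.emb {0..<1} {0} ?X \<inter> space (M 0) = A"
    using sets.sets_into_space[OF sets_A] by (auto simp: prod_emb_def PiE_iff extensional_def)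
  finally show ?thesis .
qed

end

context
  fixes P :: "nat \<Rightarrow> (nat \<Rightarrow> 'a) \<Rightarrow> 'a measure" and Q :: "'l \<Rightarrow> nat \<Rightarrow> (nat \<Rightarrow> 'a) \<Rightarrow> 'a measure"
    and M :: "nat \<Rightarrow> 'a measure" and p :: "'l pmf"
  assumes kernel_P: "Ionescu_Tulcea P M" and kernel_Q: "\<And>l. Ionescu_Tulcea (Q l) M"
    and initial: "P 0 (\<lambda>_. undefined) = measure_pmf p \<bind> (\<lambda>l. Q l 0 (\<lambda>_. undefined))"
    and transitions: "\<And>l i. 0 < i \<Longrightarrow> Q l i = P i"
begin

interpretation P: Ionescu_Tulcea P M by (rule kernel_P)
interpretation Q: Ionescu_Tulcea "Q l" M for l by (rule kernel_Q)

lemma Ionescu_Tulcea_C_mixture: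
  assumes "1 \<le> n"
  shows "P.C 0 n (\<lambda>_. undefined) = measure_pmf p \<bind> (\<lambda>l. Q.C l 0 n (\<lambda>_. undefined))"
proof -
  obtain m where n_eq: "n = 1 + m"
    using assms by (rule less_eqE)
  let ?u = "\<lambda>_. undefined :: 'a" and ?S = "\<lambda>n. PiM {0::nat..<n} M"
  have undefined_in_space: "?u \<in> space (?S 0)"
    by (simp add: space_PiM)
  have measurable_upd: "fun_upd ?u 0 \<in> M 0 \<rightarrow>\<^sub>M ?S 1"
    by (rule measurable_fun_upd[where J = "{}"]) (auto simp: space_PiM)
  have measurable_Q_0: "(\<lambda>l. Q l 0 ?u) \<in> measure_pmf p \<rightarrow>\<^sub>M subprob_algebra (M 0)"
    using measurable_space[OF Q.P undefined_in_space] by (simp add: Pi_iff)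
  have measurable_C_Q: "(\<lambda>l. Q.C l 0 1 ?u) \<in> measure_pmf p \<rightarrow>\<^sub>M subprob_algebra (?S 1)"
    using measurable_space[OF Q.measurable_C undefined_in_space, of _ 1] by (simp add: Pi_iff del: Q.C.simps)
  have C_tail_eq: "P.C 1 m = Q.C l 1 m" for l
    by (intro Ionescu_Tulcea_C_cong kernel_P kernel_Q) (simp add: transitions)
  have "P.C 0 1 ?u = measure_pmf p \<bind> (\<lambda>l. Q.C l 0 1 ?u)"
    unfolding P.C_0_1 Q.C_0_1 P.eP_def Q.eP_def initial
    using distr_bind[OF measurable_Q_0 _ measurable_upd] by simp
  then have "P.C 0 n ?u = (measure_pmf p \<bind> (\<lambda>l. Q.C l 0 1 ?u)) \<bind> P.C 1 m"
    using P.split_C[OF undefined_in_space, of 1 m] by (simp add: n_eq del: P.C.simps Q.C.simps)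
  also have "\<dots> = measure_pmf p \<bind> (\<lambda>l. Q.C l 0 1 ?u \<bind> Q.C l 1 m)"
    using bind_assoc[OF measurable_C_Q P.measurable_C[of 1 m]] by (simp only: C_tail_eq[symmetric])
  also have "\<dots> = measure_pmf p \<bind> (\<lambda>l. Q.C l 0 n ?u)"
    using Q.split_C[OF undefined_in_space, of _ 1 m] by (simp add: n_eq del: Q.C.simps)
  finally show ?thesis .
qed

lemma Ionescu_Tulcea_lim_mixture: "P.PF.lim = measure_pmf p \<bind> (\<lambda>l. Q.PF.lim l)"
proof (rule measure_eqI_PiM_infinite[where I = UNIV and M = M])
  let ?u = "\<lambda>_. undefined :: 'a"
  show "finite_measure P.PF.lim"
    using P.prob_space_lim by (rule prob_space.finite_measure)
  have measurable_lim_Q: "Q.PF.lim \<in> measure_pmf p \<rightarrow>\<^sub>M subprob_algebra (PiM UNIV M)"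
    using Q.prob_space_lim by (auto simp: space_subprob_algebra prob_space_imp_subprob_space)
  then show "sets (measure_pmf p \<bind> Q.PF.lim) = sets (PiM UNIV M)"
    by (intro sets_bind) auto
  fix A and J :: "nat set"
  assume finite_J: "finite J" and sets_A: "\<And>i. i \<in> J \<Longrightarrow> A i \<in> sets (M i)"
  let ?X = "Pi\<^sub>E J A"
  obtain n where bound_J: "J \<subseteq> {0..<n}" "1 \<le> n"
  proof
    show "J \<subseteq> {0..<Suc (Max (insert 0 J))}" "1 \<le> Suc (Max (insert 0 J))"
      using finite_J by (auto simp: less_Suc_eq_le)
  qed
  have sets_X: "?X \<in> sets (PiM J M)"
    using finite_J sets_A by (rule sets_PiM_I_finite)
  have measurable_C_Q: "(\<lambda>l. Q.C l 0 n ?u) \<in> measure_pmf p \<rightarrow>\<^sub>M subprob_algebra (PiM {0..<n} M)"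
    using measurable_space[OF Q.measurable_C[of _ 0 n], of ?u] by (simp add: space_PiM Pi_iff)
  have "emeasure P.PF.lim (prod_emb UNIV M J ?X) =
      emeasure (measure_pmf p \<bind> (\<lambda>l. Q.C l 0 n ?u)) (prod_emb {0..<n} M J ?X)"
    using P.emeasure_lim_emb_eq_C[OF bound_J(1) sets_X] by (simp add: Ionescu_Tulcea_C_mixture[OF bound_J(2)])
  also have "\<dots> = (\<integral>\<^sup>+ l. emeasure (Q.C l 0 n ?u) (prod_emb {0..<n} M J ?X) \<partial>measure_pmf p)"
    using sets_X bound_J(1) by (intro emeasure_bind[OF _ measurable_C_Q]) auto
  also have "\<dots> = (\<integral>\<^sup>+ l. emeasure (Q.PF.lim l) (prod_emb UNIV M J ?X) \<partial>measure_pmf p)"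
    by (simp add: Q.emeasure_lim_emb_eq_C[OF bound_J(1) sets_X])
  also have "\<dots> = emeasure (measure_pmf p \<bind> Q.PF.lim) (prod_emb UNIV M J ?X)"
    using sets_X finite_J by (intro emeasure_bind[OF _ measurable_lim_Q, symmetric]) auto
  finally show "emeasure P.PF.lim (prod_emb UNIV M J ?X) =
      emeasure (measure_pmf p \<bind> Q.PF.lim) (prod_emb UNIV M J ?X)" .
qed simp

end

section \<open>The law of the controlled process\<close>

abbreviation path_space :: "'y::polish_space path measure" where
  "path_space \<equiv> \<Pi>\<^sub>M i\<in>UNIV. coord_space"

lemma
  fixes t :: nat
  shows latent_measurable: "Measurable.pred path_space (latent t)"
    and response_measurable: "response t \<in> borel_measurable path_space"
proof -
  have [measurable]: "(\<lambda>\<omega>. \<omega> t) \<in> path_space \<rightarrow>\<^sub>M count_space UNIV \<Otimes>\<^sub>M borel"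
    unfolding coord_space_def by (rule measurable_component_singleton) simp
  show "Measurable.pred path_space (latent t)" "response t \<in> borel_measurable path_space"
    unfolding latent_def response_def by measurable
qed

lemma one_divide_one_plus_odds: "1 / (1 + \<gamma>) = ennreal (1 - prior_prob \<gamma>)"
proof (cases \<gamma>)
  case (real r)
  then have "1 / (1 + \<gamma>) = ennreal (1 / (1 + r))"
    by (simp add: divide_ennreal flip: ennreal_1 ennreal_plus)
  also have "1 / (1 + r) = 1 - prior_prob \<gamma>"
    using real by (simp add: prior_prob_def field_simps)
  finally show ?thesis .
qed (simp add: prior_prob_def)

lemma step_kernel_0_degenerate:
  "step_kernel M \<delta> (if l then \<infinity> else 0) \<zeta> 0 \<omega> = return coord_space (l, undefined)"
proof -
  have "bernoulli_pmf (prior_prob (if l then \<infinity> else 0)) = return_pmf l"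
  proof (rule pmf_eqI)
    show "pmf (bernoulli_pmf (prior_prob (if l then \<infinity> else 0))) i = pmf (return_pmf l) i" for i
      by (cases l; cases i) (simp_all add: prior_prob_def)
  qed
  then show ?thesis
    by (simp add: step_kernel_def return_pmf.rep_eq distr_return)
qed

context
  fixes M :: "('y::polish_space) cp_model" and \<delta> :: "'y rule"
  assumes model: "markov_model M" and rule: "assignment_rule M \<delta>"
begin

lemma space_law: "space (law M \<delta> \<gamma> \<zeta>) = UNIV"
  using sets_eq_imp_space_eq[OF sets_law[OF model rule]] by (simp add: space_PiM)

lemma law_mixture:
  "law M \<delta> \<gamma> \<zeta> =
    measure_pmf (bernoulli_pmf (prior_prob \<gamma>)) \<bind> (\<lambda>l. law M \<delta> (if l then \<infinity> else 0) \<zeta>)"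
  unfolding law_def
proof (rule Ionescu_Tulcea_lim_mixture)
  let ?u = "\<lambda>_. undefined :: bool \<times> 'y"
  show "step_kernel M \<delta> \<gamma> \<zeta> 0 ?u = measure_pmf (bernoulli_pmf (prior_prob \<gamma>)) \<bind>
      (\<lambda>l. step_kernel M \<delta> (if l then \<infinity> else 0) \<zeta> 0 ?u)"
    unfolding step_kernel_0_degenerate
    by (simp add: step_kernel_def bind_return_distr')
  show "step_kernel M \<delta> (if l then \<infinity> else 0) \<zeta> i = step_kernel M \<delta> \<gamma> \<zeta> i" if "0 < i" for l i
    using that by (simp add: fun_eq_iff step_kernel_def)
qed (intro Ionescu_Tulcea_step_kernel model rule)+

lemma nn_integral_law_mixture:
  assumes "f \<in> borel_measurable path_space"
  shows "(\<integral>\<^sup>+ \<omega>. f \<omega> \<partial>law M \<delta> \<gamma> \<zeta>) =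
    ennreal (prior_prob \<gamma>) * (\<integral>\<^sup>+ \<omega>. f \<omega> \<partial>law M \<delta> \<infinity> \<zeta>) +
    ennreal (1 - prior_prob \<gamma>) * (\<integral>\<^sup>+ \<omega>. f \<omega> \<partial>law M \<delta> 0 \<zeta>)"
proof -
  have "(\<lambda>l. law M \<delta> (if l then \<infinity> else 0) \<zeta>) \<in>
      measure_pmf (bernoulli_pmf (prior_prob \<gamma>)) \<rightarrow>\<^sub>M subprob_algebra path_space"
    using sets_law[OF model rule] prob_space_law[OF model rule]
    by (auto simp: space_subprob_algebra prob_space_imp_subprob_space)
  from nn_integral_bind[OF assms this] show ?thesis
    using prior_prob_bounds[of \<gamma>] by (subst law_mixture) (simp add: mult.commute)
qed

lemma emeasure_law_mixture:
  assumes "A \<in> sets path_space"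
  shows "emeasure (law M \<delta> \<gamma> \<zeta>) A =
    ennreal (prior_prob \<gamma>) * emeasure (law M \<delta> \<infinity> \<zeta>) A +
    ennreal (1 - prior_prob \<gamma>) * emeasure (law M \<delta> 0 \<zeta>) A"
  using nn_integral_law_mixture[OF borel_measurable_indicator[OF assms], of \<gamma> \<zeta>] assms
  by (simp add: sets_law[OF model rule])

lemma emeasure_law_not_latent_0:
  "emeasure (law M \<delta> \<gamma> \<zeta>) {\<omega>. \<not> latent 0 \<omega>} = ennreal (1 - prior_prob \<gamma>)"
proof -
  interpret Ionescu_Tulcea "step_kernel M \<delta> \<gamma> \<zeta>" "\<lambda>_. coord_space"
    by (rule Ionescu_Tulcea_step_kernel[OF model rule])
  let ?A = "{z :: bool \<times> 'y. \<not> fst z}"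
  have "Measurable.pred (coord_space :: (bool \<times> 'y) measure) (\<lambda>z. \<not> fst z)"
    unfolding coord_space_def by measurable
  then have sets_A: "?A \<in> sets coord_space"
    by (simp add: pred_def)
  have "emeasure (law M \<delta> \<gamma> \<zeta>) {\<omega>. \<not> latent 0 \<omega>} =
      emeasure (step_kernel M \<delta> \<gamma> \<zeta> 0 (\<lambda>_. undefined)) ?A"
    using emeasure_lim_component_0[OF sets_A] by (simp add: law_def latent_def space_PiM)
  also have "\<dots> = emeasure (measure_pmf (bernoulli_pmf (prior_prob \<gamma>))) {False}"
    using sets_A by (auto simp: step_kernel_def emeasure_distr intro: arg_cong2[where f = emeasure])
  also have "\<dots> = ennreal (1 - prior_prob \<gamma>)"
    using prior_prob_bounds[of \<gamma>] by (simp add: emeasure_pmf_single)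
  finally show ?thesis .
qed

lemma history_measurable:
  "(\<lambda>\<omega>. \<lambda>s\<in>{1..t}. (treatment \<delta> s \<omega>, response s \<omega>)) \<in> path_space \<rightarrow>\<^sub>M hist_space M {1..t}"
  unfolding hist_space_def
proof (intro measurable_restrict measurable_Pair)
  fix s assume "s \<in> {1..t}"
  then show "treatment \<delta> s \<in> path_space \<rightarrow>\<^sub>M count_space {1..arms M}"
    by (intro treatment_measurable[OF rule]) auto
qed (rule response_measurable)

lemma pred_filt_imp_pred_path_space:
  assumes "Measurable.pred (filt M \<delta> t) P"
  shows "Measurable.pred path_space P"
proof -
  have "(\<lambda>\<omega>. \<omega>) \<in> path_space \<rightarrow>\<^sub>M filt M \<delta> t"
    unfolding filt_def using history_measurable by (intro measurable_vimage_algebra2) auto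
  from measurable_compose[OF this assms] show ?thesis .
qed

end

lemma filt_0_trivial:
  assumes "Measurable.pred (filt M \<delta> 0) P"
  shows "P \<omega> \<longleftrightarrow> P \<omega>'"
proof -
  have "{\<omega>. P \<omega>} \<in> sets (filt M \<delta> 0)"
    using assms by (simp add: pred_def filt_def)
  then obtain A where "{\<omega>. P \<omega>} = (\<lambda>\<omega>. \<lambda>s\<in>{1..0}. (treatment \<delta> s \<omega>, response s \<omega>)) -` A"
    unfolding filt_def by (subst (asm) sets_vimage_algebra2) (auto simp: hist_space_def space_PiM)
  then have "P \<omega> \<longleftrightarrow> (\<lambda>_. undefined) \<in> A" for \<omega>
    by (auto simp: set_eq_iff restrict_def)
  then show ?thesis
    by simp
qed

lemma change_point_le_iff: "change_point \<omega> \<le> enat t \<longleftrightarrow> (\<exists>s\<le>t. latent s \<omega>)"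
proof
  assume "change_point \<omega> \<le> enat t"
  then have "(INF s\<in>{s. latent s \<omega>}. enat s) < enat (Suc t)"
    by (simp add: change_point_def order_le_less_trans)
  then show "\<exists>s\<le>t. latent s \<omega>"
    by (auto simp: INF_less_iff less_Suc_eq_le)
qed (auto simp: change_point_def intro: INF_lower2)

lemma change_point_eq_0_iff: "change_point \<omega> = 0 \<longleftrightarrow> latent 0 \<omega>"
  using change_point_le_iff[of \<omega> 0] by (simp flip: zero_enat_def)

lemma change_point_measurable: "change_point \<in> borel_measurable path_space"
proof (rule borel_measurable_enatI)
  note latent_measurable [measurable]
  show "Measurable.pred path_space (\<lambda>\<omega>. change_point \<omega> \<le> enat t)" for t
    unfolding change_point_le_iff by measurable
qed

section \<open>The cost of a procedure\<close>

context
  fixes M :: "('y::polish_space) cp_model" and \<delta> :: "'y rule" and T :: "'y path \<Rightarrow> enat"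
  assumes model: "markov_model M" and procedure: "(\<delta>, T) \<in> procedures M"
begin

lemma
  shows procedure_rule: "assignment_rule M \<delta>"
    and procedure_stopping_time: "Measurable.pred (filt M \<delta> t) (\<lambda>\<omega>. T \<omega> \<le> enat t)"
  using procedure by (auto simp: procedures_def)

lemma stopping_time_measurable: "T \<in> borel_measurable path_space"
  by (rule borel_measurable_enatI)
    (rule pred_filt_imp_pred_path_space[OF model procedure_rule procedure_stopping_time])

lemma early_stop_sets: "{\<omega>. T \<omega> < change_point \<omega>} \<in> sets path_space"
  using borel_measurable_less[OF stopping_time_measurable change_point_measurable]
  by (simp add: space_PiM)

lemma aux_cost_mixture:
  "aux_cost M c \<gamma> \<zeta> \<delta> T =
    ennreal (prior_prob \<gamma>) * aux_cost M c \<infinity> \<zeta> \<delta> T +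
    ennreal (1 - prior_prob \<gamma>) * aux_cost M c 0 \<zeta> \<delta> T"
proof -
  have [measurable]: "T \<in> borel_measurable path_space"
    by (rule stopping_time_measurable)
  have "(\<lambda>\<omega>. ennreal_of_enat (T \<omega>)) \<in> borel_measurable path_space"
    by measurable
  from nn_integral_law_mixture[OF model procedure_rule this, of \<gamma> \<zeta>]
    emeasure_law_mixture[OF model procedure_rule early_stop_sets, of \<gamma> \<zeta>]
  show ?thesis
    unfolding aux_cost_def by (simp only: distrib_left ac_simps)
qed

lemma aux_cost_affine:
  assumes "0 \<le> \<gamma>"
  shows "(1 + ennreal \<gamma>) * aux_cost M c (ennreal \<gamma>) \<zeta> \<delta> T =
    ennreal \<gamma> * aux_cost M c \<infinity> \<zeta> \<delta> T + aux_cost M c 0 \<zeta> \<delta> T"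
proof -
  let ?p = "prior_prob (ennreal \<gamma>)"
  have "(1 + \<gamma>) * ?p = \<gamma>" "(1 + \<gamma>) * (1 - ?p) = 1"
    using assms by (auto simp: prior_prob_def field_simps)
  then have "(1 + ennreal \<gamma>) * ennreal ?p = ennreal \<gamma>" "(1 + ennreal \<gamma>) * ennreal (1 - ?p) = 1"
    using assms prior_prob_bounds[of "ennreal \<gamma>"]
    by (simp_all flip: ennreal_plus ennreal_1 ennreal_mult)
  then show ?thesis
    by (subst aux_cost_mixture) (simp add: distrib_left mult.assoc[symmetric])
qed

lemma aux_cost_bounded_finite:
  assumes "\<And>\<omega>. T \<omega> \<le> enat n"
  shows "aux_cost M c \<gamma> \<zeta> \<delta> T < \<infinity>"
proof -
  interpret prob_space "law M \<delta> \<gamma> \<zeta>"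
    by (rule prob_space_law[OF model procedure_rule])
  have "(\<integral>\<^sup>+ \<omega>. ennreal_of_enat (T \<omega>) \<partial>law M \<delta> \<gamma> \<zeta>) \<le> (\<integral>\<^sup>+ \<omega>. of_nat n \<partial>law M \<delta> \<gamma> \<zeta>)"
    using assms by (intro nn_integral_mono) (simp flip: ennreal_of_enat_enat)
  also have "\<dots> < \<infinity>"
    by (simp add: emeasure_space_1 of_nat_less_top)
  finally have "ennreal c * (\<integral>\<^sup>+ \<omega>. ennreal_of_enat (T \<omega>) \<partial>law M \<delta> \<gamma> \<zeta>) < \<infinity>"
    by (simp add: ennreal_mult_less_top)
  then show ?thesis
    unfolding aux_cost_def by (simp add: emeasure_finite less_top[symmetric])
qed

lemma one_divide_le_aux_cost_iff:
  assumes "0 \<le> \<gamma>" and bound: "\<And>\<omega>. T \<omega> \<le> enat n"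
  shows "1 / (1 + ennreal \<gamma>) \<le> aux_cost M c (ennreal \<gamma>) \<zeta> \<delta> T \<longleftrightarrow>
    1 \<le> \<gamma> * enn2real (aux_cost M c \<infinity> \<zeta> \<delta> T) + enn2real (aux_cost M c 0 \<zeta> \<delta> T)"
proof -
  define u v where "u = enn2real (aux_cost M c \<infinity> \<zeta> \<delta> T)" and "v = enn2real (aux_cost M c 0 \<zeta> \<delta> T)"
  have aux_cost_eq: "aux_cost M c \<infinity> \<zeta> \<delta> T = ennreal u" "aux_cost M c 0 \<zeta> \<delta> T = ennreal v" "0 \<le> u" "0 \<le> v"
    using aux_cost_bounded_finite[OF bound] by (auto simp: u_def v_def less_top)
  have "1 / (1 + ennreal \<gamma>) \<le> aux_cost M c (ennreal \<gamma>) \<zeta> \<delta> T \<longleftrightarrow>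
      1 \<le> (1 + ennreal \<gamma>) * aux_cost M c (ennreal \<gamma>) \<zeta> \<delta> T"
    by (intro divide_le_iff_ennreal) auto
  also have "\<dots> \<longleftrightarrow> 1 \<le> ennreal (\<gamma> * u + v)"
    using \<open>0 \<le> \<gamma>\<close> aux_cost_eq by (simp add: aux_cost_affine ennreal_mult)
  also have "\<dots> \<longleftrightarrow> 1 \<le> \<gamma> * u + v"
    by simp
  finally show ?thesis
    by (simp add: u_def v_def)
qed

lemma aux_cost_immediate:
  assumes "\<And>\<omega>. T \<omega> = 0"
  shows "aux_cost M c \<gamma> \<zeta> \<delta> T = 1 / (1 + \<gamma>)"
  using assms emeasure_law_not_latent_0[OF model procedure_rule]
  by (simp add: aux_cost_def change_point_eq_0_iff one_divide_one_plus_odds)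

lemma aux_cost_ge_const:
  assumes "\<And>\<omega>. 1 \<le> T \<omega>"
  shows "ennreal c \<le> aux_cost M c \<gamma> \<zeta> \<delta> T"
proof -
  interpret prob_space "law M \<delta> \<gamma> \<zeta>"
    by (rule prob_space_law[OF model procedure_rule])
  have "1 = (\<integral>\<^sup>+ \<omega>. 1 \<partial>law M \<delta> \<gamma> \<zeta>)"
    by (simp add: emeasure_space_1)
  also have "\<dots> \<le> (\<integral>\<^sup>+ \<omega>. ennreal_of_enat (T \<omega>) \<partial>law M \<delta> \<gamma> \<zeta>)"
    using assms by (intro nn_integral_mono) (simp flip: ennreal_of_enat_1)
  finally have "ennreal c * 1 \<le> ennreal c * (\<integral>\<^sup>+ \<omega>. ennreal_of_enat (T \<omega>) \<partial>law M \<delta> \<gamma> \<zeta>)"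
    by (rule mult_left_mono) simp
  then show ?thesis
    unfolding aux_cost_def by (simp add: add_increasing2)
qed

lemma aux_cost_ge_min: "min (ennreal c) (1 / (1 + \<gamma>)) \<le> aux_cost M c \<gamma> \<zeta> \<delta> T"
proof (cases "\<exists>\<omega>. T \<omega> = 0")
  case True
  then have "T \<omega> = 0" for \<omega>
    using filt_0_trivial[OF procedure_stopping_time[of 0]] by (auto simp flip: zero_enat_def)
  then show ?thesis
    by (simp add: aux_cost_immediate)
next
  case False
  then have "1 \<le> T \<omega>" for \<omega>
    by (auto simp: one_eSuc intro!: ileI1 zero_less_iff_neq_zero[THEN iffD2])
  then show ?thesis
    by (simp add: aux_cost_ge_const min.coboundedI1)
qed

lemma truncated_procedure: "(\<delta>, \<lambda>\<omega>. min (T \<omega>) (enat n)) \<in> procedures M"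
  using procedure by (auto simp: procedures_def min_le_iff_disj intro: pred_intros_logic)

lemma aux_cost_truncated_le:
  "aux_cost M c \<gamma> \<zeta> \<delta> (\<lambda>\<omega>. min (T \<omega>) (enat n)) \<le>
    aux_cost M c \<gamma> \<zeta> \<delta> T + emeasure (law M \<delta> \<gamma> \<zeta>) {\<omega>. enat n < T \<omega>}"
proof -
  let ?L = "law M \<delta> \<gamma> \<zeta>" and ?A = "{\<omega>. T \<omega> < change_point \<omega>}" and ?B = "{\<omega>. enat n < T \<omega>}"
  have sets_AB: "?A \<in> sets ?L" "?B \<in> sets ?L"
    using early_stop_sets borel_measurable_less[OF borel_measurable_const stopping_time_measurable]
    by (simp_all add: sets_law[OF model procedure_rule] space_PiM)
  have "emeasure ?L {\<omega>. min (T \<omega>) (enat n) < change_point \<omega>} \<le> emeasure ?L (?A \<union> ?B)"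
    using sets_AB by (intro emeasure_mono) (auto simp: min_def split: if_splits)
  also have "\<dots> \<le> emeasure ?L ?A + emeasure ?L ?B"
    using sets_AB by (rule emeasure_subadditive)
  finally have "emeasure ?L {\<omega>. min (T \<omega>) (enat n) < change_point \<omega>} \<le> emeasure ?L ?A + emeasure ?L ?B" .
  moreover have "ennreal c * (\<integral>\<^sup>+ \<omega>. ennreal_of_enat (min (T \<omega>) (enat n)) \<partial>?L) \<le>
      ennreal c * (\<integral>\<^sup>+ \<omega>. ennreal_of_enat (T \<omega>) \<partial>?L)"
    by (intro mult_left_mono nn_integral_mono) auto
  ultimately show ?thesis
    unfolding aux_cost_def add.assoc by (rule add_mono[rotated])
qed

lemma aux_cost_ge_truncatedI:
  assumes "0 < c" and le_truncated: "\<And>n. a \<le> aux_cost M c \<gamma> \<zeta> \<delta> (\<lambda>\<omega>. min (T \<omega>) (enat n))"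
  shows "a \<le> aux_cost M c \<gamma> \<zeta> \<delta> T"
proof (cases "aux_cost M c \<gamma> \<zeta> \<delta> T = \<infinity>")
  case False
  let ?L = "law M \<delta> \<gamma> \<zeta>"
  from False have "ennreal c * (\<integral>\<^sup>+ \<omega>. ennreal_of_enat (T \<omega>) \<partial>?L) < \<infinity>"
    by (simp add: aux_cost_def less_top[symmetric])
  then have "(\<integral>\<^sup>+ \<omega>. ennreal_of_enat (T \<omega>) \<partial>?L) < \<infinity>"
    using \<open>0 < c\<close> by (auto simp: ennreal_mult_less_top)
  moreover have "T \<in> borel_measurable ?L"
    using stopping_time_measurable
    by (simp add: measurable_cong_sets[OF sets_law[OF model procedure_rule] refl])
  ultimately have "(\<lambda>n. emeasure ?L {\<omega>. enat n < T \<omega>}) \<longlonglongrightarrow> 0"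
    using tendsto_emeasure_enat_tail[of T ?L] by (simp add: space_law[OF model procedure_rule])
  then have "(\<lambda>n. aux_cost M c \<gamma> \<zeta> \<delta> T + emeasure ?L {\<omega>. enat n < T \<omega>}) \<longlonglongrightarrow>
      aux_cost M c \<gamma> \<zeta> \<delta> T + 0"
    by (intro tendsto_add tendsto_const)
  then show ?thesis
    using order_trans[OF le_truncated aux_cost_truncated_le] by (simp add: LIMSEQ_le_const)
qed simp

end

section \<open>The stopping region\<close>

definition stopping_region ::
  "('y::polish_space) cp_model \<Rightarrow> real \<Rightarrow> (nat \<Rightarrow> real) \<Rightarrow> ennreal set" where
  "stopping_region M c \<zeta> = {\<gamma>. 1 / (1 + \<gamma>) \<le> opt_cost M c \<gamma> \<zeta> False}"

definition bounded_procedures ::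
  "('y::polish_space) cp_model \<Rightarrow> ('y rule \<times> ('y path \<Rightarrow> enat)) set" where
  "bounded_procedures M = {(\<delta>, T) \<in> procedures M. \<exists>n. \<forall>\<omega>. T \<omega> \<le> enat n}"

context
  fixes M :: "('y::polish_space) cp_model" and c :: real
  assumes model: "markov_model M" and cost_pos: "0 < c"
begin

lemma opt_cost_eq_INF_bounded:
  "opt_cost M c \<gamma> \<zeta> False = (INF (\<delta>, T)\<in>bounded_procedures M. aux_cost M c \<gamma> \<zeta> \<delta> T)"
proof -
  let ?I = "INF (\<delta>, T)\<in>bounded_procedures M. aux_cost M c \<gamma> \<zeta> \<delta> T"
  have "?I \<le> aux_cost M c \<gamma> \<zeta> \<delta> T" if "(\<delta>, T) \<in> procedures M" for \<delta> T
  proof (rule aux_cost_ge_truncatedI[OF model that cost_pos])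
    have "(\<delta>, \<lambda>\<omega>. min (T \<omega>) (enat n)) \<in> bounded_procedures M" for n
      using truncated_procedure[OF model that, of n]
      by (auto simp: bounded_procedures_def intro!: exI[of _ n])
    then show "?I \<le> aux_cost M c \<gamma> \<zeta> \<delta> (\<lambda>\<omega>. min (T \<omega>) (enat n))" for n
      by (intro INF_lower2) auto
  qed
  then have "?I \<le> (INF (\<delta>, T)\<in>procedures M. aux_cost M c \<gamma> \<zeta> \<delta> T)"
    by (intro INF_greatest) auto
  moreover have "(INF (\<delta>, T)\<in>procedures M. aux_cost M c \<gamma> \<zeta> \<delta> T) \<le> ?I"
    by (intro INF_superset_mono) (auto simp: bounded_procedures_def)
  ultimately show ?thesis
    by (simp add: opt_cost_def order_antisym)
qed

lemma ennreal_mem_stopping_region_iff: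
  assumes "0 \<le> \<gamma>"
  shows "ennreal \<gamma> \<in> stopping_region M c \<zeta> \<longleftrightarrow>
    (\<forall>(\<delta>, T)\<in>bounded_procedures M.
       1 \<le> \<gamma> * enn2real (aux_cost M c \<infinity> \<zeta> \<delta> T) + enn2real (aux_cost M c 0 \<zeta> \<delta> T))"
proof -
  have "1 / (1 + ennreal \<gamma>) \<le> aux_cost M c (ennreal \<gamma>) \<zeta> \<delta> T \<longleftrightarrow>
      1 \<le> \<gamma> * enn2real (aux_cost M c \<infinity> \<zeta> \<delta> T) + enn2real (aux_cost M c 0 \<zeta> \<delta> T)"
    if "(\<delta>, T) \<in> bounded_procedures M" for \<delta> T
  proof -
    from that obtain n where procedure: "(\<delta>, T) \<in> procedures M" and bound: "\<And>\<omega>. T \<omega> \<le> enat n"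
      by (auto simp: bounded_procedures_def)
    from one_divide_le_aux_cost_iff[OF model procedure assms bound] show ?thesis .
  qed
  then show ?thesis
    by (auto simp: stopping_region_def opt_cost_eq_INF_bounded le_INF_iff)
qed

lemma stopping_region_upward_closed:
  assumes "ennreal \<gamma> \<in> stopping_region M c \<zeta>" "0 \<le> \<gamma>" "\<gamma> \<le> \<gamma>'"
  shows "ennreal \<gamma>' \<in> stopping_region M c \<zeta>"
proof -
  have "\<gamma> * enn2real u + v \<le> \<gamma>' * enn2real u + v" for u v
    using \<open>\<gamma> \<le> \<gamma>'\<close> by (simp add: mult_right_mono)
  then show ?thesis
    using assms by (fastforce simp: ennreal_mem_stopping_region_iff intro: order_trans)
qed

lemma closed_real_stopping_region: "closed {\<gamma>. 0 \<le> \<gamma> \<and> ennreal \<gamma> \<in> stopping_region M c \<zeta>}"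
proof -
  have "{\<gamma>. 0 \<le> \<gamma> \<and> ennreal \<gamma> \<in> stopping_region M c \<zeta>} =
      {0..} \<inter> (\<Inter>(\<delta>, T)\<in>bounded_procedures M.
        {\<gamma>. 1 \<le> \<gamma> * enn2real (aux_cost M c \<infinity> \<zeta> \<delta> T) + enn2real (aux_cost M c 0 \<zeta> \<delta> T)})"
    by (auto simp: ennreal_mem_stopping_region_iff)
  also have "closed \<dots>"
    by (intro closed_Int closed_atLeast closed_INT) (auto intro!: closed_Collect_le continuous_intros)
  finally show ?thesis .
qed

lemma inverse_const_mem_stopping_region: "ennreal (1 / c) \<in> stopping_region M c \<zeta>"
proof -
  have "1 / (1 + ennreal (1 / c)) \<le> ennreal c"
    using cost_pos by (simp add: divide_le_iff_ennreal distrib_right flip: ennreal_mult)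
  then have "1 / (1 + ennreal (1 / c)) = min (ennreal c) (1 / (1 + ennreal (1 / c)))"
    by (simp add: min_def)
  also have "\<dots> \<le> opt_cost M c (ennreal (1 / c)) \<zeta> False"
    by (auto simp: opt_cost_def intro!: INF_greatest aux_cost_ge_min[OF model])
  finally show ?thesis
    by (simp add: stopping_region_def)
qed

lemma stopping_region_eq_atLeast: "\<exists>b\<ge>0. stopping_region M c \<zeta> = {ennreal b..}"
proof -
  define S where "S = {\<gamma>. 0 \<le> \<gamma> \<and> ennreal \<gamma> \<in> stopping_region M c \<zeta>}"
  have bdd_below_S: "bdd_below S"
    by (rule bdd_belowI[of _ 0]) (simp add: S_def)
  have "S \<noteq> {}"
    using inverse_const_mem_stopping_region cost_pos by (auto simp: S_def intro!: exI[of _ "1 / c"])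
  then have Inf_S: "Inf S \<in> S"
    using bdd_below_S closed_real_stopping_region by (intro closed_contains_Inf) (simp_all add: S_def)
  have "\<gamma> \<in> stopping_region M c \<zeta> \<longleftrightarrow> ennreal (Inf S) \<le> \<gamma>" for \<gamma>
  proof (cases \<gamma>)
    case (real x)
    then have "\<gamma> \<in> stopping_region M c \<zeta> \<longleftrightarrow> x \<in> S"
      by (simp add: S_def)
    also have "\<dots> \<longleftrightarrow> Inf S \<le> x"
      using Inf_S cInf_lower[OF _ bdd_below_S] stopping_region_upward_closed[of "Inf S" \<zeta> x]
      by (auto simp: S_def)
    finally show ?thesis
      using real by simp
  qed (simp add: stopping_region_def)
  then have "stopping_region M c \<zeta> = {ennreal (Inf S)..}"
    by auto
  moreover have "0 \<le> Inf S"
    using Inf_S by (simp add: S_def)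
  ultimately show ?thesis
    by blast
qed

end

theorem theorem3p1:
  fixes M :: "('y::polish_space) cp_model" and c :: real
  assumes "markov_model M" and "c > 0"
  shows "\<exists>b :: (nat \<Rightarrow> real) \<Rightarrow> real.
    (\<forall>s\<in>euclid (stat_dim M). 0 \<le> b s) \<and>
    (\<forall>(\<gamma>::real) \<zeta> \<Gamma> \<delta> T. 0 \<le> \<gamma> \<longrightarrow> \<zeta> \<in> euclid (stat_dim M) \<longrightarrow>
       star_procedure M c (ennreal \<gamma>) \<zeta> \<Gamma> \<delta> T \<longrightarrow>
       (\<forall>\<omega>. T \<omega> = (INF t\<in>{t. \<Gamma> t \<omega> \<ge> ennreal (b (suff_stat M \<delta> \<zeta> t \<omega>))}. enat t))) \<and>
    (stat_dim M = 0 \<longrightarrow> b constant_on euclid (stat_dim M))"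
proof -
  obtain b where b_nonneg: "\<And>s. 0 \<le> b s" and region_eq: "\<And>s. stopping_region M c s = {ennreal (b s)..}"
    using stopping_region_eq_atLeast[OF assms] by metis
  have stop_iff: "1 / (1 + \<gamma>) \<le> opt_cost M c \<gamma> s False \<longleftrightarrow> ennreal (b s) \<le> \<gamma>" for \<gamma> s
    using region_eq[of s] by (auto simp: stopping_region_def)
  show ?thesis
  proof (intro exI[of _ b] conjI ballI allI impI)
    show "0 \<le> b s" for s
      by (rule b_nonneg)
    show "T \<omega> = (INF t\<in>{t. \<Gamma> t \<omega> \<ge> ennreal (b (suff_stat M \<delta> \<zeta> t \<omega>))}. enat t)"
      if "star_procedure M c (ennreal \<gamma>) \<zeta> \<Gamma> \<delta> T" for \<gamma> \<zeta> \<Gamma> \<delta> T \<omega>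
      using that by (simp add: star_procedure_def stop_iff)
    show "b constant_on euclid (stat_dim M)" if "stat_dim M = 0"
      using that by (auto simp: constant_on_def euclid_def)
  qed
qed

end
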